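(* Let $T$ be the time horizon and let $\rho$ be a fixed quantum state on a finite-dimensional Hilbert space, unknown to the learner. At each round $t\in\{1,\dots,T\}$ the adversary selects a $K$-outcome measurement $(E_{t,1},E_{t,2},\dots,E_{t,K})$, and the learner, whose prediction is $x_t\in[0,1]^K$, incurs the squared $L_2$ loss \[ \|x_t-b_t\|_2^2,\qquad b_t=\big(\operatorname{tr}(E_{t,1}\rho),\operatorname{tr}(E_{t,2}\rho),\dots,\operatorname{tr}(E_{t,K}\rho)\big)^{\top}, \] where $b_t$ is the vector of true measurement outcome probabilities. Then the regret of the Follow-the-Leader (averaging) algorithm is bounded by \[ \mathcal{R}_T\le\mathcal{O}(\log T). \] In particular, the regret grows only logarithmically with the time horizon and is independent of the number of qubits and the number $K$ of measurement outcomes.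
   Context: A quantum state is a positive semidefinite operator of trace one. A $K$-outcome measurement here is a tuple of operators with $E_{t,i}\succeq 0$ for all $i$ and $\sum_{i=1}^K E_{t,i}\preceq\mathbb{1}$, where $\mathbb{1}$ is the identity. In round $t$ the learner outputs $x_t$, incurs the loss $\|x_t-b_t\|_2^2$, and then $b_t$ is revealed. The regret is \[ \mathcal{R}_T=\sum_{t=1}^T\|x_t-b_t\|_2^2-\min_{x\in\mathbb{R}^K}\sum_{t=1}^T\|x-b_t\|_2^2 . \] The Follow-the-Leader (averaging) algorithm predicts $x_t=\frac{1}{t-1}\sum_{i=1}^{t-1}b_i$ for $t\ge 2$, with $x_1$ arbitrary.
   Formalization: For arbitrary x_1 in [0,1]^K the bound C log T (C absolute) is stated for T large depending on K; for all T ≥ 2 uniformly in K it is stated when the entries of x_1 sum to at most 1, since x_1 = (1,…,1) with all b_t = 0 gives regret K. *)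

theory Defs
  imports "HOL-Analysis.L2_Norm" "Jordan_Normal_Form.Matrix"
begin

text \<open>
  A Hilbert space of dimension \<open>d\<close> is taken in coordinates as \<open>\<complex>\<^sup>d\<close>, its operators being
  the elements of \<^term>\<open>carrier_mat d d :: complex mat set\<close>. The dimension is thus an ordinary
  natural number, so a constant can be stated to be independent of it.
  Rounds and measurement outcomes are numbered from 1; a point of \<open>\<real>\<^sup>K\<close> is a function on
  the naturals of which only the values on \<open>{1..K}\<close> are used.
\<close>

text \<open>
  The order on \<^typ>\<open>complex\<close> makes \<open>0 \<le> z\<close> say that \<open>z\<close> is real and nonnegative. Over the complex
  numbers the condition therefore forces \<open>A\<close> to be Hermitian.
\<close>

definition psd :: "nat \<Rightarrow> complex mat \<Rightarrow> bool" where
  "psd d A \<longleftrightarrow> A \<in> carrier_mat d d \<and> (\<forall>v \<in> carrier_vec d. 0 \<le> (A *\<^sub>v v) \<bullet>c v)"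

definition loewner_le :: "nat \<Rightarrow> complex mat \<Rightarrow> complex mat \<Rightarrow> bool" where
  "loewner_le d A B \<longleftrightarrow> A \<in> carrier_mat d d \<and> B \<in> carrier_mat d d \<and> psd d (B - A)"

definition mat_trace :: "complex mat \<Rightarrow> complex" where
  "mat_trace A = (\<Sum>k<dim_row A. A $$ (k, k))"

text \<open>Matrices of variable size form no additive monoid, hence the entrywise sum.\<close>

definition mat_sum :: "nat \<Rightarrow> (nat \<Rightarrow> complex mat) \<Rightarrow> nat set \<Rightarrow> complex mat" where
  "mat_sum d F I = mat d d (\<lambda>(r, c). \<Sum>i\<in>I. F i $$ (r, c))"

definition quantum_state :: "nat \<Rightarrow> complex mat \<Rightarrow> bool" where
  "quantum_state d \<rho> \<longleftrightarrow> psd d \<rho> \<and> mat_trace \<rho> = 1"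

definition measurement :: "nat \<Rightarrow> nat \<Rightarrow> (nat \<Rightarrow> complex mat) \<Rightarrow> bool" where
  "measurement d K M \<longleftrightarrow>
     (\<forall>i\<in>{1..K}. psd d (M i)) \<and> loewner_le d (mat_sum d M {1..K}) (1\<^sub>m d)"

text \<open>For positive semidefinite arguments the trace is real, so taking the real part is only a cast.\<close>

definition outcome_probs ::
  "complex mat \<Rightarrow> (nat \<Rightarrow> nat \<Rightarrow> complex mat) \<Rightarrow> nat \<Rightarrow> nat \<Rightarrow> real" where
  "outcome_probs \<rho> E t i = Re (mat_trace (E t i * \<rho>))"

definition sq_loss :: "nat \<Rightarrow> (nat \<Rightarrow> real) \<Rightarrow> (nat \<Rightarrow> real) \<Rightarrow> real" where
  "sq_loss K x b = (L2_set (\<lambda>i. x i - b i) {1..K})\<^sup>2"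

text \<open>
  The infimum ranges over all of \<open>\<real>\<^sup>K\<close>. It is a minimum, attained at the average
  of \<open>b 1, \<dots>, b T\<close>.
\<close>

definition regret :: "nat \<Rightarrow> nat \<Rightarrow> (nat \<Rightarrow> nat \<Rightarrow> real) \<Rightarrow> (nat \<Rightarrow> nat \<Rightarrow> real) \<Rightarrow> real" where
  "regret K T x b =
     (\<Sum>t=1..T. sq_loss K (x t) (b t)) - (INF y. \<Sum>t=1..T. sq_loss K y (b t))"

text \<open>Follow-the-Leader with first prediction \<open>x1\<close>.\<close>

definition ftl :: "(nat \<Rightarrow> real) \<Rightarrow> (nat \<Rightarrow> nat \<Rightarrow> real) \<Rightarrow> nat \<Rightarrow> nat \<Rightarrow> real" where
  "ftl x1 b t i = (if t \<le> 1 then x1 i else (\<Sum>s=1..t - 1. b s i) / real (t - 1))"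

definition ftl_regret ::
  "nat \<Rightarrow> nat \<Rightarrow> complex mat \<Rightarrow> (nat \<Rightarrow> nat \<Rightarrow> complex mat) \<Rightarrow> (nat \<Rightarrow> real) \<Rightarrow> real" where
  "ftl_regret K T \<rho> E x1 =
     regret K T (ftl x1 (outcome_probs \<rho> E)) (outcome_probs \<rho> E)"

end

theory Submission
  imports Defs "HOL-Analysis.Harmonic_Numbers"
begin

text \<open>
  Completing the square shows that the regret of Follow-the-Leader against any fixed comparator is
  at most \<open>\<Sum>t\<le>T. \<parallel>x\<^sub>t - b\<^sub>t\<parallel>\<^sup>2 / t\<close>. The outcome vectors \<open>b\<^sub>t\<close>, and hence
  their averages \<open>x\<^sub>t\<close> for \<open>t \<ge> 2\<close>, have nonnegative entries of sum at most 1, because the trace of a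
  product of two positive semidefinite matrices is nonnegative. So each numerator with
  \<open>t \<ge> 2\<close> is at most 2, whatever the dimension and \<open>K\<close>, and the harmonic sum is logarithmic.
\<close>

section \<open>Traces of products of positive semidefinite matrices\<close>

text \<open>The value \<open>v\<^sup>* A v\<close>. Entries are given by functions, so passing to
  the leading block of \<open>A\<close> only changes \<open>d\<close>, and \<open>v(d := z)\<close>
  supplies a last coordinate.\<close>

definition sesq_form :: "nat \<Rightarrow> (nat \<Rightarrow> nat \<Rightarrow> complex) \<Rightarrow> (nat \<Rightarrow> complex) \<Rightarrow> complex" where
  "sesq_form d A v = (\<Sum>i<d. \<Sum>j<d. A i j * v j * cnj (v i))"

lemma sesq_form_Suc:
  "sesq_form (Suc d) A (v(d := z)) =
     sesq_form d A v + z * (\<Sum>i<d. A i d * cnj (v i)) + cnj z * (\<Sum>j<d. A d j * v j)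
       + A d d * z * cnj z"
  by (simp add: sesq_form_def sum.distrib sum_distrib_left algebra_simps)

lemma psd_sesq_form:
  assumes "psd d A"
  shows "0 \<le> sesq_form d (\<lambda>i j. A $$ (i, j)) v"
proof -
  have A: "A \<in> carrier_mat d d" and "0 \<le> (A *\<^sub>v Matrix.vec d v) \<bullet>c Matrix.vec d v"
    using assms by (auto simp: psd_def)
  moreover have "(A *\<^sub>v Matrix.vec d v) \<bullet>c Matrix.vec d v = sesq_form d (\<lambda>i j. A $$ (i, j)) v"
    using A by (auto simp: sesq_form_def scalar_prod_def sum_distrib_right lessThan_atLeast0
        intro!: sum.cong)
  ultimately show ?thesis by simp
qed

text \<open>The cross terms are \<open>z * p + cnj z * q\<close>, and nonnegativity makes the form
  real for every \<open>z\<close>; comparing imaginary parts at \<open>0\<close>, \<open>1\<close>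
  and \<open>\<i>\<close> forces conjugacy.\<close>

lemma sesq_form_cross_cnj:
  assumes "\<And>v. 0 \<le> sesq_form (Suc d) A v"
  shows "(\<Sum>j<d. A d j * v j) = cnj (\<Sum>i<d. A i d * cnj (v i))"
proof -
  define p where "p = (\<Sum>i<d. A i d * cnj (v i))"
  define q where "q = (\<Sum>j<d. A d j * v j)"
  have *: "0 \<le> sesq_form d A v + z * p + cnj z * q + A d d * z * cnj z" for z
    using assms[of "v(d := z)"] by (simp add: sesq_form_Suc p_def q_def)
  have "0 \<le> sesq_form (Suc d) A ((\<lambda>_. 0)(d := 1))"
    by (rule assms)
  then have "Im (A d d) = 0"
    unfolding sesq_form_Suc by (simp add: less_eq_complex_def sesq_form_def)
  then have "Im p + Im q = 0" "Re p = Re q"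
    using *[of 0] *[of 1] *[of \<i>] by (simp_all add: less_eq_complex_def)
  then have "q = cnj p" by (simp add: complex_eq_iff)
  then show ?thesis by (simp only: p_def q_def)
qed

lemma sesq_form_diag_nonneg:
  assumes "\<And>v. 0 \<le> sesq_form (Suc d) A v"
  shows "0 \<le> A d d"
  using assms[of "(\<lambda>_. 0)(d := 1)"] unfolding sesq_form_Suc by (simp add: sesq_form_def)

lemma sesq_form_hermitian_last:
  assumes "\<And>v. 0 \<le> sesq_form (Suc d) A v" and "i < d"
  shows "A d i = cnj (A i d)"
  using sesq_form_cross_cnj[OF assms(1), of "\<lambda>k. if k = i then 1 else 0"] \<open>i < d\<close>
  by (simp add: if_distrib[of cnj] if_distrib[of "(*) _"] cong: if_cong)

text \<open>With a zero pivot the form is real-affine in the last coordinate, so a nonzero cross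
  term would drive it below zero.\<close>

lemma sesq_form_zero_diag:
  assumes pos: "\<And>v. 0 \<le> sesq_form (Suc d) A v" and "i < d" and "A d d = 0"
  shows "A i d = 0"
proof (rule ccontr)
  assume nz: "A i d \<noteq> 0"
  define e where "e = (\<lambda>k. if k = i then 1 else 0 :: complex)"
  define r where "r = Re (sesq_form d A e)"
  \<comment> \<open>This step length gives the form the real part
    \<open>r - (r + 1)\<close>.\<close>
  define s where "s = (r + 1) / (2 * (norm (A i d))\<^sup>2)"
  have col: "(\<Sum>k<d. A k d * cnj (e k)) = A i d"
    using \<open>i < d\<close> by (simp add: e_def if_distrib[of cnj] if_distrib[of "(*) _"] cong: if_cong)
  have row: "(\<Sum>k<d. A d k * e k) = cnj (A i d)"
    using sesq_form_cross_cnj[OF pos, of e] by (simp add: col)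
  have "0 \<le> sesq_form (Suc d) A (e(d := - of_real s * cnj (A i d)))"
    by (rule pos)
  then have "0 \<le> r - 2 * s * ((Re (A i d))\<^sup>2 + (Im (A i d))\<^sup>2)"
    unfolding sesq_form_Suc col row
    by (simp add: \<open>A d d = 0\<close> less_eq_complex_def r_def power2_eq_square algebra_simps)
  also have "\<dots> = -1"
    unfolding cmod_power2[symmetric] using nz by (simp add: s_def field_simps)
  finally show False by simp
qed

text \<open>
  Induction on the dimension: eliminating the last row and column of \<open>A\<close> splits off a rank-one
  summand and leaves the Schur complement, which is again positive semidefinite.
  If the pivot \<open>A d d\<close> vanishes, so do its row and column, and division by zero makes the summand 0.
\<close>

lemma trace_mult_sesq_form_nonneg:
  assumes "\<And>v. 0 \<le> sesq_form d A v" and "\<And>v. 0 \<le> sesq_form d B v"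
  shows "0 \<le> (\<Sum>i<d. \<Sum>j<d. B i j * A j i)"
  using assms
proof (induction d arbitrary: A)
  case 0
  then show ?case by simp
next
  case (Suc d)
  define a where "a = A d d"
  define A' where "A' = (\<lambda>i j. A i j - A i d * A d j / a)"
  have a: "0 \<le> a"
    unfolding a_def using Suc.prems(1) by (rule sesq_form_diag_nonneg)
  then have cnj_a: "cnj a = a"
    by (simp add: less_eq_complex_def complex_eq_iff)
  have herm: "A d i = cnj (A i d)" if "i < d" for i
    using Suc.prems(1) that by (rule sesq_form_hermitian_last)
  have zero: "A i d = 0" if "i < d" "a = 0" for i
    using sesq_form_zero_diag[OF Suc.prems(1)] that by (simp add: a_def)
  have A': "0 \<le> sesq_form d A' v" for v
  proof -
    define p where "p = (\<Sum>i<d. A i d * cnj (v i))"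
    define q where "q = (\<Sum>j<d. A d j * v j)"
    have q: "q = cnj p"
      unfolding p_def q_def by (rule sesq_form_cross_cnj[OF Suc.prems(1)])
    have "p * q / a = (\<Sum>i<d. \<Sum>j<d. (A i d * cnj (v i)) * (A d j * v j) / a)"
      by (simp only: p_def q_def sum_product sum_divide_distrib)
    then have "sesq_form d A' v = sesq_form d A v - p * q / a"
      by (simp add: sesq_form_def A'_def sum_subtractf algebra_simps)
    \<comment> \<open>For \<open>a \<noteq> 0\<close> the last coordinate \<open>- q / a\<close>
      minimises the form of \<open>A\<close>, by completing the square; for \<open>a = 0\<close> it
      is 0 and both corrections vanish.\<close>
    also have "\<dots> = sesq_form (Suc d) A (v(d := - q / a))"
      unfolding sesq_form_Suc p_def[symmetric] q_def[symmetric] a_def[symmetric]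
      by (cases "a = 0") (simp_all add: q cnj_a)
    finally show ?thesis using Suc.prems(1) by simp
  qed
  have B: "0 \<le> sesq_form d B v" for v
    using Suc.prems(2)[of "v(d := 0)"] unfolding sesq_form_Suc by simp
  \<comment> \<open>For \<open>a \<noteq> 0\<close> the split-off summand is
    \<open>w w\<^sup>* / a\<close>, so its trace against \<open>B\<close> is the form of
    \<open>B\<close> at \<open>w\<close>, divided by \<open>a\<close>.\<close>
  define w where "w = (\<lambda>i. A i d)"
  have w: "sesq_form (Suc d) B w = (\<Sum>i<d. \<Sum>j<d. B i j * (A j d * A d i))
      + (\<Sum>i<d. B i d * A d i) * a + (\<Sum>j<d. B d j * A j d) * a + B d d * a * a"
    by (simp add: sesq_form_def w_def herm cnj_a flip: a_def)
       (simp add: sum.distrib sum_distrib_left sum_distrib_right algebra_simps)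
  have "(\<Sum>i<Suc d. \<Sum>j<Suc d. B i j * A j i) =
      (\<Sum>i<d. \<Sum>j<d. B i j * A j i) + (\<Sum>i<d. B i d * A d i) + (\<Sum>j<d. B d j * A j d) + B d d * a"
    by (simp add: sum.distrib a_def algebra_simps)
  also have "\<dots> = (\<Sum>i<d. \<Sum>j<d. B i j * A' j i) + sesq_form (Suc d) B w / a"
  proof (cases "a = 0")
    case True
    then show ?thesis by (simp add: A'_def herm zero)
  next
    case False
    have "(\<Sum>i<d. \<Sum>j<d. B i j * A' j i) =
        (\<Sum>i<d. \<Sum>j<d. B i j * A j i) - (\<Sum>i<d. \<Sum>j<d. B i j * (A j d * A d i)) / a"
      by (simp add: A'_def sum_divide_distrib sum_subtractf algebra_simps)
    with False show ?thesis
      unfolding w by (simp add: add_divide_distrib)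
  qed
  also have "0 \<le> \<dots>"
    using Suc.IH[OF A' B] Suc.prems(2)[of w] a
    by (auto simp: less_eq_complex_def Re_divide Im_divide)
  finally show ?case .
qed

lemma mat_trace_mult:
  assumes "A \<in> carrier_mat d d" and "B \<in> carrier_mat d d"
  shows "mat_trace (A * B) = (\<Sum>i<d. \<Sum>j<d. A $$ (i, j) * B $$ (j, i))"
  using assms by (auto simp: mat_trace_def scalar_prod_def lessThan_atLeast0 intro!: sum.cong)

lemma psd_trace_mult_nonneg:
  assumes "psd d A" and "psd d B"
  shows "0 \<le> mat_trace (A * B)"
proof -
  have "A \<in> carrier_mat d d" "B \<in> carrier_mat d d"
    using assms by (auto simp: psd_def)
  then show ?thesis
    unfolding mat_trace_mult
    using trace_mult_sesq_form_nonneg[OF psd_sesq_form psd_sesq_form, OF assms(2,1)]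
    by (simp add: mat_trace_mult)
qed

section \<open>Outcome probabilities\<close>

lemma outcome_probs_nonneg:
  assumes "quantum_state d \<rho>" and "measurement d K (E t)" and "i \<in> {1..K}"
  shows "0 \<le> outcome_probs \<rho> E t i"
  using psd_trace_mult_nonneg[of d "E t i" \<rho>] assms
  by (auto simp: outcome_probs_def quantum_state_def measurement_def less_eq_complex_def)

text \<open>The identity minus the sum of the measurement operators is positive semidefinite, so its
  trace against \<open>\<rho>\<close> is nonnegative; linearity and trace one do the rest.\<close>

lemma sum_outcome_probs_le_1:
  assumes \<rho>: "quantum_state d \<rho>" and M: "measurement d K (E t)"
  shows "(\<Sum>i=1..K. outcome_probs \<rho> E t i) \<le> 1"
proof -
  let ?S = "mat_sum d (E t) {1..K}"
  have E: "E t i \<in> carrier_mat d d" if "i \<in> {1..K}" for i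
    using M that by (auto simp: measurement_def psd_def)
  have R: "\<rho> \<in> carrier_mat d d" and tr: "mat_trace \<rho> = 1" and psd: "psd d \<rho>"
    using \<rho> by (auto simp: quantum_state_def psd_def)
  have S: "?S \<in> carrier_mat d d" by (simp add: mat_sum_def)
  have "psd d (1\<^sub>m d - ?S)"
    using M by (simp add: measurement_def loewner_le_def)
  then have "0 \<le> mat_trace ((1\<^sub>m d - ?S) * \<rho>)"
    using psd by (rule psd_trace_mult_nonneg)
  also have "(1\<^sub>m d - ?S) * \<rho> = \<rho> - ?S * \<rho>"
    using minus_mult_distrib_mat[OF one_carrier_mat S R] left_mult_one_mat[OF R] by (simp only:)
  also have "mat_trace \<dots> = 1 - mat_trace (?S * \<rho>)"
    using R S tr by (auto simp: mat_trace_def sum_subtractf simp del: index_mult_mat(1))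
  also have "mat_trace (?S * \<rho>) = (\<Sum>k<d. \<Sum>l<d. \<Sum>i=1..K. E t i $$ (k, l) * \<rho> $$ (l, k))"
    unfolding mat_trace_mult[OF S R] by (simp add: mat_sum_def sum_distrib_right)
  also have "\<dots> = (\<Sum>i=1..K. \<Sum>k<d. \<Sum>l<d. E t i $$ (k, l) * \<rho> $$ (l, k))"
    by (simp only: sum.swap[of _ "{1..K}"])
  also have "\<dots> = (\<Sum>i=1..K. mat_trace (E t i * \<rho>))"
    by (intro sum.cong refl mat_trace_mult[OF E R, symmetric])
  finally show ?thesis
    by (simp add: less_eq_complex_def outcome_probs_def)
qed

section \<open>Regret of Follow-the-Leader\<close>

text \<open>At \<open>n = 0\<close> the factor \<open>real n\<close> cancels the arbitrary first
  prediction, so the running-mean recursion holds from the start.\<close>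

lemma ftl_Suc_Suc:
  "ftl x1 b (Suc (Suc n)) i = (real n * ftl x1 b (Suc n) i + b (Suc n) i) / real (Suc n)"
  by (cases n) (simp_all add: ftl_def)

text \<open>The term with factor \<open>real T\<close> is the excess loss of the comparator
  \<open>y\<close> over the mean of the first \<open>T\<close> values; carrying it along gives an
  exact identity, suited to induction.\<close>

lemma ftl_sq_identity:
  "(\<Sum>t=1..T. (ftl x1 b t i - b t i)\<^sup>2) + real T * (y - ftl x1 b (Suc T) i)\<^sup>2 =
   (\<Sum>t=1..T. (y - b t i)\<^sup>2) + (\<Sum>t=1..T. (ftl x1 b t i - b t i)\<^sup>2 / real t)"
proof (induction T)
  case 0
  then show ?case by simp
next
  case (Suc n)
  define m where "m = ftl x1 b (Suc n) i"
  define c where "c = b (Suc n) i"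
  define N where "N = real (Suc n)"
  have N: "N > 0" "real n = N - 1" by (simp_all add: N_def)
  have m': "ftl x1 b (Suc (Suc n)) i = ((N - 1) * m + c) / N"
    unfolding ftl_Suc_Suc m_def c_def N_def by simp
  \<comment> \<open>The increments of the two sides of the identity in round
    \<open>Suc n\<close>.\<close>
  have "(m - c)\<^sup>2 + N * (y - ((N - 1) * m + c) / N)\<^sup>2 - (N - 1) * (y - m)\<^sup>2 =
      (y - c)\<^sup>2 + (m - c)\<^sup>2 / N"
    using N(1) by (simp add: field_simps power2_eq_square)
  with Suc.IH show ?case
    by (simp add: m' flip: m_def c_def N_def) (simp add: N(2))
qed

lemma sq_loss_eq: "sq_loss K x b = (\<Sum>i=1..K. (x i - b i)\<^sup>2)"
  by (simp add: sq_loss_def L2_set_def sum_nonneg)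

text \<open>Dropping the nonnegative excess term of \<open>ftl_sq_identity\<close> and summing over
  coordinates bounds every comparator's loss from below, hence also the infimum.\<close>

lemma regret_ftl_le:
  "regret K T (ftl x1 b) b \<le> (\<Sum>t=1..T. sq_loss K (ftl x1 b t) (b t) / real t)"
proof -
  let ?x = "ftl x1 b"
  let ?L = "\<Sum>t=1..T. sq_loss K (?x t) (b t)"
  let ?B = "\<Sum>t=1..T. sq_loss K (?x t) (b t) / real t"
  have "?L - ?B \<le> (\<Sum>t=1..T. sq_loss K y (b t))" for y
  proof -
    have "?L = (\<Sum>i=1..K. \<Sum>t=1..T. (?x t i - b t i)\<^sup>2)"
      unfolding sq_loss_eq by (rule sum.swap)
    also have "\<dots> \<le> (\<Sum>i=1..K. (\<Sum>t=1..T. (y i - b t i)\<^sup>2) + (\<Sum>t=1..T. (?x t i - b t i)\<^sup>2 / real t))"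
    proof (rule sum_mono)
      fix i
      have "0 \<le> real T * (y i - ?x (Suc T) i)\<^sup>2" by simp
      then show "(\<Sum>t=1..T. (?x t i - b t i)\<^sup>2)
          \<le> (\<Sum>t=1..T. (y i - b t i)\<^sup>2) + (\<Sum>t=1..T. (?x t i - b t i)\<^sup>2 / real t)"
        using ftl_sq_identity[of x1 b i T "y i"] by linarith
    qed
    also have "\<dots> = (\<Sum>i=1..K. \<Sum>t=1..T. (y i - b t i)\<^sup>2)
        + (\<Sum>i=1..K. \<Sum>t=1..T. (?x t i - b t i)\<^sup>2 / real t)"
      by (rule sum.distrib)
    also have "(\<Sum>i=1..K. \<Sum>t=1..T. (y i - b t i)\<^sup>2) = (\<Sum>t=1..T. sq_loss K y (b t))"
      unfolding sq_loss_eq by (rule sum.swap)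
    also have "(\<Sum>i=1..K. \<Sum>t=1..T. (?x t i - b t i)\<^sup>2 / real t) = ?B"
      unfolding sq_loss_eq sum_divide_distrib by (rule sum.swap)
    finally show ?thesis by simp
  qed
  then have "?L - ?B \<le> (INF y. \<Sum>t=1..T. sq_loss K y (b t))"
    by (intro cINF_greatest) auto
  then show ?thesis by (simp add: regret_def)
qed

section \<open>Dimension-free loss bounds and the logarithmic estimate\<close>

text \<open>Each entry is at most the sum, hence at most 1, so squaring does not increase it. This
  keeps \<open>K\<close> out of the bounds.\<close>

lemma sum_power2_le_1:
  fixes x :: "'a \<Rightarrow> real"
  assumes "\<And>i. i \<in> I \<Longrightarrow> 0 \<le> x i" and "sum x I \<le> 1" and "finite I"
  shows "(\<Sum>i\<in>I. (x i)\<^sup>2) \<le> 1"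
proof -
  have "(\<Sum>i\<in>I. (x i)\<^sup>2) \<le> sum x I"
  proof (rule sum_mono)
    fix i assume i: "i \<in> I"
    have "x i \<le> sum x I"
      using assms i by (intro member_le_sum) auto
    with assms i show "(x i)\<^sup>2 \<le> x i"
      by (auto simp: power2_eq_square intro!: mult_left_le)
  qed
  with assms(2) show ?thesis by simp
qed

text \<open>Nonnegative entries make the cross terms nonpositive, which leaves the two squared
  norms, each at most 1.\<close>

lemma sq_loss_le_2:
  assumes "\<And>i. i \<in> {1..K} \<Longrightarrow> 0 \<le> x i" and "(\<Sum>i=1..K. x i) \<le> 1"
    and "\<And>i. i \<in> {1..K} \<Longrightarrow> 0 \<le> b i" and "(\<Sum>i=1..K. b i) \<le> 1"
  shows "sq_loss K x b \<le> 2"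
proof -
  have "sq_loss K x b \<le> (\<Sum>i=1..K. (x i)\<^sup>2 + (b i)\<^sup>2)"
    unfolding sq_loss_eq using assms(1,3)
    by (intro sum_mono) (simp add: power2_diff)
  also have "\<dots> \<le> 1 + 1"
    unfolding sum.distrib using assms by (intro add_mono sum_power2_le_1) auto
  finally show ?thesis by simp
qed

text \<open>Nonnegative vectors of sum at most 1 form a convex set; from \<open>t = 2\<close> on the
  prediction is an average of such vectors.\<close>

lemma ftl_average_bounds:
  assumes "2 \<le> t"
    and "\<And>s i. s \<in> {1..t - 1} \<Longrightarrow> i \<in> {1..K} \<Longrightarrow> 0 \<le> b s i"
    and "\<And>s. s \<in> {1..t - 1} \<Longrightarrow> (\<Sum>i=1..K. b s i) \<le> 1"
  shows "\<And>i. i \<in> {1..K} \<Longrightarrow> 0 \<le> ftl x1 b t i" and "(\<Sum>i=1..K. ftl x1 b t i) \<le> 1"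
proof -
  show "0 \<le> ftl x1 b t i" if "i \<in> {1..K}" for i
    using assms that by (auto simp: ftl_def intro!: divide_nonneg_nonneg sum_nonneg)
  have "(\<Sum>i=1..K. ftl x1 b t i) = (\<Sum>s=1..t - 1. \<Sum>i=1..K. b s i) / real (t - 1)"
    using assms(1) by (subst sum.swap) (simp add: ftl_def sum_divide_distrib)
  also have "(\<Sum>s=1..t - 1. \<Sum>i=1..K. b s i) \<le> (\<Sum>s=1..t - 1. 1)"
    using assms(3) by (rule sum_mono)
  finally show "(\<Sum>i=1..K. ftl x1 b t i) \<le> 1"
    using assms(1) by (simp add: divide_right_mono)
qed

lemma sum_inverse_from_2_le_ln:
  assumes "1 \<le> T"
  shows "(\<Sum>t=2..T. 1 / real t) \<le> ln (real T)"
proof -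
  have "harm T = 1 + (\<Sum>t=2..T. 1 / real t)"
    using assms by (simp add: harm_def sum.atLeast_Suc_atMost numeral_2_eq_2 inverse_eq_divide)
  \<comment> \<open>\<open>harm n - ln n\<close> is decreasing and equals 1 at \<open>n = 1\<close>;
    omitting the term \<open>t = 1\<close> removes precisely this 1.\<close>
  with euler_mascheroni_sequence_decreasing[of 1 T] assms show ?thesis by (simp add: harm_expand)
qed

text \<open>The first prediction is no average, so its loss stays as a separate term; each later
  round contributes at most \<open>2 / t\<close>.\<close>

lemma regret_ftl_le_ln:
  assumes "1 \<le> T"
    and nonneg: "\<And>t i. t \<in> {1..T} \<Longrightarrow> i \<in> {1..K} \<Longrightarrow> 0 \<le> b t i"
    and sum_le: "\<And>t. t \<in> {1..T} \<Longrightarrow> (\<Sum>i=1..K. b t i) \<le> 1"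
  shows "regret K T (ftl x1 b) b \<le> sq_loss K x1 (b 1) + 2 * ln (real T)"
proof -
  let ?loss = "\<lambda>t. sq_loss K (ftl x1 b t) (b t)"
  have "regret K T (ftl x1 b) b \<le> (\<Sum>t=1..T. ?loss t / real t)"
    by (rule regret_ftl_le)
  also have "\<dots> = ?loss 1 + (\<Sum>t=2..T. ?loss t / real t)"
    using assms(1) by (simp add: sum.atLeast_Suc_atMost numeral_2_eq_2)
  also have "?loss 1 = sq_loss K x1 (b 1)"
    by (simp add: sq_loss_eq ftl_def)
  also have "(\<Sum>t=2..T. ?loss t / real t) \<le> (\<Sum>t=2..T. 2 * (1 / real t))"
  proof (rule sum_mono)
    fix t assume t: "t \<in> {2..T}"
    have "?loss t \<le> 2"
    proof (rule sq_loss_le_2)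
      show "0 \<le> ftl x1 b t i" if "i \<in> {1..K}" for i
        using t that by (intro ftl_average_bounds(1)[where K = K] nonneg sum_le) auto
      show "(\<Sum>i=1..K. ftl x1 b t i) \<le> 1"
        using t by (intro ftl_average_bounds(2) nonneg sum_le) auto
    qed (use t in \<open>auto intro: nonneg simp: sum_le[simplified]\<close>)
    then show "?loss t / real t \<le> 2 * (1 / real t)"
      by (simp add: divide_right_mono)
  qed
  also have "\<dots> \<le> 2 * ln (real T)"
    unfolding sum_distrib_left[symmetric]
    using sum_inverse_from_2_le_ln[OF assms(1)] by simp
  finally show ?thesis by simp
qed

lemma ftl_regret_le_ln:
  assumes "1 \<le> T" and "quantum_state d \<rho>" and "\<forall>t\<in>{1..T}. measurement d K (E t)"
  shows "ftl_regret K T \<rho> E x1 \<le> sq_loss K x1 (outcome_probs \<rho> E 1) + 2 * ln (real T)"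
  unfolding ftl_regret_def using assms
  by (intro regret_ftl_le_ln outcome_probs_nonneg sum_outcome_probs_le_1) auto

text \<open>A crude bound for the first round, where \<open>x1\<close> may be any point of the
  cube.\<close>

lemma sq_loss_le_card:
  assumes "\<And>i. i \<in> {1..K} \<Longrightarrow> x i \<in> {0..1}" and "\<And>i. i \<in> {1..K} \<Longrightarrow> b i \<in> {0..1}"
  shows "sq_loss K x b \<le> real K"
proof -
  have "(\<Sum>i=1..K. (x i - b i)\<^sup>2) \<le> (\<Sum>i=1..K. 1)"
  proof (rule sum_mono)
    fix i assume "i \<in> {1..K}"
    then have "\<bar>x i - b i\<bar> \<le> 1" using assms by fastforce
    then show "(x i - b i)\<^sup>2 \<le> 1" by (simp add: abs_square_le_1)
  qed
  then show ?thesis by (simp add: sq_loss_eq)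
qed

text \<open>Only the first loss depends on \<open>x1\<close>. In the cube it may grow with
  \<open>K\<close>, so there \<open>T\<close> must be large depending on \<open>K\<close>, while
  \<open>C\<close> stays universal; with entry sum at most 1 it is at most 2, which covers all
  \<open>T \<ge> 2\<close>. At \<open>T = 1\<close> the logarithm is 0.\<close>

theorem proposition2p5:
  shows "\<exists>C::real.
    (\<forall>K::nat. \<forall>\<^sub>F T in sequentially. \<forall>(d::nat) \<rho> E x1.
       quantum_state d \<rho> \<and> (\<forall>t\<in>{1..T}. measurement d K (E t)) \<and>
       (\<forall>i\<in>{1..K}. x1 i \<in> {0..1})
       \<longrightarrow> ftl_regret K T \<rho> E x1 \<le> C * ln (real T)) \<and>
    (\<forall>(K::nat) (T::nat) (d::nat) \<rho> E x1.
       2 \<le> T \<and> quantum_state d \<rho> \<and> (\<forall>t\<in>{1..T}. measurement d K (E t)) \<and>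
       (\<forall>i\<in>{1..K}. x1 i \<in> {0..1}) \<and> (\<Sum>i=1..K. x1 i) \<le> 1
       \<longrightarrow> ftl_regret K T \<rho> E x1 \<le> C * ln (real T))"
proof (intro exI[of _ 6] conjI allI impI)
  fix K :: nat
  have "filterlim (\<lambda>T. ln (real T)) at_top sequentially"
    by (rule filterlim_compose[OF ln_at_top filterlim_real_sequentially])
  \<comment> \<open>Beyond this threshold, which depends on \<open>K\<close> alone, one
    \<open>ln T\<close> absorbs the first loss.\<close>
  then have "\<forall>\<^sub>F T in sequentially. real K \<le> ln (real T)"
    by (simp add: filterlim_at_top)
  with eventually_ge_at_top[of 1]
  show "\<forall>\<^sub>F T in sequentially. \<forall>(d::nat) \<rho> E x1.
       quantum_state d \<rho> \<and> (\<forall>t\<in>{1..T}. measurement d K (E t)) \<and>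
       (\<forall>i\<in>{1..K}. x1 i \<in> {0..1})
       \<longrightarrow> ftl_regret K T \<rho> E x1 \<le> 6 * ln (real T)"
  proof eventually_elim
    case (elim T)
    show ?case
    proof (intro allI impI, elim conjE)
      fix d \<rho> E and x1 :: "nat \<Rightarrow> real"
      assume \<rho>: "quantum_state d \<rho>" and M: "\<forall>t\<in>{1..T}. measurement d K (E t)"
        and x1: "\<forall>i\<in>{1..K}. x1 i \<in> {0..1}"
      have M1: "measurement d K (E 1)" using M elim(1) by auto
      note b0 = outcome_probs_nonneg[where E = E and t = 1, OF \<rho> M1]
      have "outcome_probs \<rho> E 1 i \<in> {0..1}" if i: "i \<in> {1..K}" for i
        using member_le_sum[OF i, of "outcome_probs \<rho> E 1"] b0 i
          sum_outcome_probs_le_1[where E = E and t = 1, OF \<rho> M1]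
        by fastforce
      then have "sq_loss K x1 (outcome_probs \<rho> E 1) \<le> real K"
        using x1 by (intro sq_loss_le_card) auto
      moreover have "0 \<le> ln (real T)" using elim(1) by simp
      ultimately show "ftl_regret K T \<rho> E x1 \<le> 6 * ln (real T)"
        using ftl_regret_le_ln[OF elim(1) \<rho> M, of x1] elim(2) by linarith
    qed
  qed
next
  fix K T d :: nat and \<rho> E and x1 :: "nat \<Rightarrow> real"
  assume "2 \<le> T \<and> quantum_state d \<rho> \<and> (\<forall>t\<in>{1..T}. measurement d K (E t)) \<and>
       (\<forall>i\<in>{1..K}. x1 i \<in> {0..1}) \<and> (\<Sum>i=1..K. x1 i) \<le> 1"
  then have T: "2 \<le> T" and \<rho>: "quantum_state d \<rho>" and M: "\<forall>t\<in>{1..T}. measurement d K (E t)"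
    and x1: "\<forall>i\<in>{1..K}. x1 i \<in> {0..1}" "(\<Sum>i=1..K. x1 i) \<le> 1" by auto
  have M1: "measurement d K (E 1)" using M T by auto
  have "sq_loss K x1 (outcome_probs \<rho> E 1) \<le> 2"
    using x1 outcome_probs_nonneg[where E = E and t = 1, OF \<rho> M1]
      sum_outcome_probs_le_1[where E = E and t = 1, OF \<rho> M1]
    by (intro sq_loss_le_2) auto
  \<comment> \<open>The first loss is thus at most \<open>4 * ln T\<close>; adding
    \<open>2 * ln T\<close> gives the constant 6.\<close>
  moreover have "1 / 2 \<le> ln (real T)"
    using ln2_ge_two_thirds T ln_mono[of 2 "real T"] by linarith
  ultimately show "ftl_regret K T \<rho> E x1 \<le> 6 * ln (real T)"
    using ftl_regret_le_ln[of T d \<rho> K E x1] T \<rho> M by simp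
qed

end
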